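(* For the representatives of the isomorphism classes of two-dimensional evolution algebras over $\mathbb{C}$ listed below (each with natural basis $\{e_1,e_2\}$), the space of $2$-coboundaries $\mathcal{B}^2(\mathcal{E})$ and the set $\operatorname{InfDef}(\mathcal{E})$ of all infinitesimal deformations up to equivalence are the following (bilinear maps are identified with their structure matrices; that a set describes the infinitesimal deformations up to equivalence means that every infinitesimal deformation is equivalent to exactly one member of the set): 1. $\mathcal{E}_1$: $e_1^2=e_1,\ e_2^2=0$. $\mathcal{B}^2=\operatorname{span}\left\{\begin{pmatrix} 1 & 0 \\ 0 & 0 \end{pmatrix},\begin{pmatrix} 0 & 1 \\ 0 & 0 \end{pmatrix}\right\}$; $\operatorname{InfDef}=\left\{\begin{pmatrix} 1 & 0 \\ 0 & 0 \end{pmatrix}+\begin{pmatrix} 0 & 0 \\ \alpha & \beta \end{pmatrix}t:\alpha,\beta\in\mathbb{C}\right\}$. 2. $\mathcal{E}_2$: $e_1^2=e_2^2=e_1$. $\mathcal{B}^2=\operatorname{span}\left\{\begin{pmatrix} -1 & 0 \\ 1 & 0 \end{pmatrix},\begin{pmatrix} 0 & 1 \\ 0 & 1 \end{pmatrix},\begin{pmatrix} 0 & 0 \\ -2 & 0 \end{pmatrix}\right\}$; $\operatorname{InfDef}=\left\{\begin{pmatrix} 1 & 0 \\ 1 & 0 \end{pmatrix}+\begin{pmatrix} 0 & 0 \\ 0 & \alpha \end{pmatrix}t:\alpha\in\mathbb{C}\right\}$. 3. $\mathcal{E}_3$: $e_1^2=-e_2^2=e_1+e_2$. $\mathcal{B}^2=\operatorname{span}\left\{\begin{pmatrix}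 1 & 1 \\ -1 & -1 \end{pmatrix},\begin{pmatrix} 0 & 1 \\ 2 & 1 \end{pmatrix}\right\}$; $\operatorname{InfDef}=\left\{\begin{pmatrix} 1 & 1 \\ -1 & -1 \end{pmatrix}+\begin{pmatrix} 0 & 0 \\ \alpha & \beta \end{pmatrix}t:\alpha,\beta\in\mathbb{C}\right\}$. 4. $\mathcal{E}_4$: $e_1^2=e_2,\ e_2^2=0$. $\mathcal{B}^2=\operatorname{span}\left\{\begin{pmatrix} 0 & 1 \\ 0 & 0 \end{pmatrix}\right\}$; $\operatorname{InfDef}=\left\{\begin{pmatrix} 0 & 1 \\ 0 & 0 \end{pmatrix}+\begin{pmatrix} \alpha & 0 \\ \beta & \gamma \end{pmatrix}t:\alpha,\beta,\gamma\in\mathbb{C}\right\}$. 5. $\mathcal{E}_5(a_2,a_3)$, with $a_2,a_3\in\mathbb{C}$ and $1-a_2a_3\ne0$: $e_1^2=e_1+a_2e_2,\ e_2^2=a_3e_1+e_2$. $\mathcal{B}^2=\operatorname{span}\left\{\begin{pmatrix} -1 & -2a_2 \\ a_3 & 0 \end{pmatrix},\begin{pmatrix} 0 & a_2 \\ -2a_3 & -1 \end{pmatrix}\right\}$; and - if $a_2\neq0$: $\operatorname{InfDef}=\left\{\begin{pmatrix} 1 & a_2 \\ a_3 & 1 \end{pmatrix}+\begin{pmatrix} 0 & 0 \\ \alpha & \beta \end{pmatrix}t:\alpha,\beta\in\mathbb{C}\right\}$; - if $a_2=a_3=0$: $\operatorname{InfDef}=\left\{\begin{pmatrix} 1 & 0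 \\ 0 & 1 \end{pmatrix}+\begin{pmatrix} 0 & \alpha \\ \beta & 0 \end{pmatrix}t:\alpha,\beta\in\mathbb{C}\right\}$; - if $a_2=0$, $a_3\ne0$: $\operatorname{InfDef}=\left\{\begin{pmatrix} 1 & 0 \\ a_3 & 1 \end{pmatrix}+\begin{pmatrix} 0 & \alpha \\ 0 & \beta \end{pmatrix}t:\alpha,\beta\in\mathbb{C}\right\}$. 6. $\mathcal{E}_6(a_4)$, with $a_4\in\mathbb{C}$: $e_1^2=e_2,\ e_2^2=e_1+a_4e_2$. $\mathcal{B}^2=\operatorname{span}\left\{\begin{pmatrix} 0 & 1 \\ -2 & -a_4 \end{pmatrix},\begin{pmatrix} 0 & -2 \\ 1 & 0 \end{pmatrix}\right\}$; $\operatorname{InfDef}=\left\{\begin{pmatrix} 0 & 1 \\ 1 & a_4 \end{pmatrix}+\begin{pmatrix} \alpha & 0 \\ 0 & \beta \end{pmatrix}t:\alpha,\beta\in\mathbb{C}\right\}$.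
   Context: An evolution algebra over a field $\mathbb{K}$ is a pair $\mathcal{E}=(V,\mu)$, where $V$ is a finite-dimensional $\mathbb{K}$-vector space and $\mu\colon V\times V\to V$ is a bilinear map admitting a basis $B=\{e_1,\dots,e_n\}$ (a natural basis, here fixed) with $\mu(e_i,e_j)=0$ for $i\neq j$; one writes $e_i^2=\mu(e_i,e_i)$. $\mathcal{Z}^2(V)$ is the space of bilinear maps $\theta\colon V\times V\to V$ with $\theta(e_i,e_j)=0$ for all $i\ne j$. Such $\theta$ is identified with its structure matrix $(\theta_{ij})$, where $\theta(e_i,e_i)=\sum_j\theta_{ij}e_j$ (row $i$ contains the coordinates of $\theta(e_i,e_i)$). For $\varphi\in\operatorname{End}_{\mathbb{K}}(V)$ put $\delta_\mu\varphi(u,v)=\varphi(\mu(u,v))-\mu(u,\varphi(v))-\mu(\varphi(u),v)$. The space of $2$-coboundaries is $\mathcal{B}^2(\mathcal{E})=\{\theta\in\mathcal{Z}^2(V):\theta=\delta_\mu\varphi\text{ for some }\varphi\in\operatorname{End}_{\mathbb{K}}(V)\}$. An infinitesimal deformation of $\mathcal{E}$ is a $\mathbb{K}[t]/(t^2)$-bilinear product $\nu_t=\mu+t\nu_1$ on $V\otimes\mathbb{K}[t]/(t^2)$ with $\nu_1\in\mathcal{Z}^2(V)$; its structure matrix is the sum of that of $\mu$ and $t$ times that of $\nu_1$. Two infinitesimal deformations $\nu_t,\lambda_t$ of $\mathcal{E}$ are equivalent if there is $\phi_t=\operatorname{Id}+t\phi_1$, with $\phi_1\in\operatorname{End}_{\mathbb{K}}(V)$,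 such that $\phi_t(\nu_t(u,v))=\lambda_t(\phi_t(u),\phi_t(v))$ modulo $t^2$ for all $u,v\in V$. *)

theory Defs
  imports "HOL-Analysis.Analysis" "HOL-Computational_Algebra.Polynomial"
begin

section \<open>The ring \<open>K[t]/(t\<^sup>2)\<close>\<close>

text \<open>\<open>Dual a b\<close> is the class of \<open>a + b t\<close>; see \<open>dual_of_poly\<close> below for the
  identification with the quotient of the polynomial ring.\<close>

datatype 'a dual_number = Dual (dconst: 'a) (dlin: 'a)

instantiation dual_number :: (comm_ring_1) comm_ring_1
begin

definition "0 = Dual 0 0"
definition "1 = Dual 1 0"
definition "x + y = Dual (dconst x + dconst y) (dlin x + dlin y)"
definition "x - y = Dual (dconst x - dconst y) (dlin x - dlin y)"
definition "- x = Dual (- dconst x) (- dlin x)"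
definition "x * y = Dual (dconst x * dconst y) (dconst x * dlin y + dlin x * dconst y)"

instance
  by standard
    (auto simp: zero_dual_number_def one_dual_number_def plus_dual_number_def
      minus_dual_number_def uminus_dual_number_def times_dual_number_def algebra_simps)

end

definition dual_of_poly :: "'a::comm_ring_1 poly \<Rightarrow> 'a dual_number" where
  "dual_of_poly p = Dual (coeff p 0) (coeff p 1)"

lemma surj_dual_of_poly: "surj dual_of_poly"
proof (rule surjI)
  show "dual_of_poly [:dconst x, dlin x:] = x" for x :: "'a dual_number"
    by (simp add: dual_of_poly_def)
qed

lemma dual_of_poly_1: "dual_of_poly 1 = 1"
  by (simp add: dual_of_poly_def one_dual_number_def)

lemma dual_of_poly_add: "dual_of_poly (p + q) = dual_of_poly p + dual_of_poly q"
  by (simp add: dual_of_poly_def plus_dual_number_def)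

lemma dual_of_poly_mult: "dual_of_poly (p * q) = dual_of_poly p * dual_of_poly q"
  by (simp add: dual_of_poly_def times_dual_number_def coeff_mult)

lemma dual_of_poly_eq_0_iff: "dual_of_poly p = 0 \<longleftrightarrow> [:0, 0, 1:] dvd p"
proof
  assume p: "dual_of_poly p = 0"
  obtain a b q where q: "p = pCons a (pCons b q)"
    by (metis pCons_cases)
  with p have "p = [:0, 0, 1:] * q"
    by (simp add: dual_of_poly_def zero_dual_number_def)
  then show "[:0, 0, 1:] dvd p"
    by (rule dvdI)
next
  assume "[:0, 0, 1:] dvd p"
  then obtain q where "p = [:0, 0, 1:] * q"
    by (rule dvdE)
  then show "dual_of_poly p = 0"
    by (simp add: dual_of_poly_def zero_dual_number_def)
qed


section \<open>Extension of scalars\<close>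

text \<open>The underlying group of \<open>V \<otimes> K[t]/(t\<^sup>2)\<close> is \<open>V \<times> V\<close>: the pair \<open>(u, v)\<close> stands for
  \<open>u \<otimes> 1 + v \<otimes> t\<close>. In particular \<open>u \<in> V\<close> is identified with \<open>(u, 0)\<close>.\<close>

definition ext_scale ::
  "('k::comm_ring_1 \<Rightarrow> 'v::ab_group_add \<Rightarrow> 'v) \<Rightarrow> 'k dual_number \<Rightarrow> 'v \<times> 'v \<Rightarrow> 'v \<times> 'v" where
  "ext_scale s c x =
     (s (dconst c) (fst x), s (dconst c) (snd x) + s (dlin c) (fst x))"

lemma module_ext_scale:
  assumes "module s"
  shows "module (ext_scale s)"
proof -
  interpret module s by fact
  show ?thesis
    by standard
      (auto simp: ext_scale_def plus_dual_number_def times_dual_number_def one_dual_number_def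
        algebra_simps)
qed

text \<open>The \<open>K[t]/(t\<^sup>2)\<close>-linear extension of \<open>Id + t f\<close>.\<close>

definition id_plus_t :: "('v::ab_group_add \<Rightarrow> 'v) \<Rightarrow> 'v \<times> 'v \<Rightarrow> 'v \<times> 'v" where
  "id_plus_t f x = (fst x, snd x + f (fst x))"

lemma module_hom_id_plus_t:
  assumes "module_hom s s f"
  shows "module_hom (ext_scale s) (ext_scale s) (id_plus_t f)"
proof -
  interpret module_hom s s f by fact
  interpret e: module "ext_scale s"
    by (rule module_ext_scale) (rule m1.module_axioms)
  show ?thesis
    by standard (auto simp: id_plus_t_def ext_scale_def add scale m1.scale_right_distrib)
qed


section \<open>Bilinear maps and structure matrices\<close>

definition bilinear_map ::
  "('r::comm_ring_1 \<Rightarrow> 'm::ab_group_add \<Rightarrow> 'm) \<Rightarrow> ('m \<Rightarrow> 'm \<Rightarrow> 'm) \<Rightarrow> bool" where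
  "bilinear_map s f \<longleftrightarrow>
     (\<forall>x. module_hom s s (f x)) \<and> (\<forall>y. module_hom s s (\<lambda>x. f x y))"

text \<open>Used over \<open>K\<close> with the basis \<open>e\<close> of \<open>V\<close>, and over \<open>K[t]/(t\<^sup>2)\<close> with the basis
  \<open>\<lambda>i. (e i, 0)\<close> of \<open>V \<otimes> K[t]/(t\<^sup>2)\<close>.\<close>

definition has_structure_matrix ::
  "('r::comm_ring_1 \<Rightarrow> 'm::ab_group_add \<Rightarrow> 'm) \<Rightarrow> ('i::finite \<Rightarrow> 'm) \<Rightarrow> ('m \<Rightarrow> 'm \<Rightarrow> 'm) \<Rightarrow>
   'r^'i^'i \<Rightarrow> bool" where
  "has_structure_matrix s e f M \<longleftrightarrow> (\<forall>i. f (e i) (e i) = (\<Sum>j\<in>UNIV. s (M $ i $ j) (e j)))"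

definition matrix_scale :: "'k::times \<Rightarrow> 'k^'n^'m \<Rightarrow> 'k^'n^'m" where
  "matrix_scale c A = (\<chi> i j. c * A $ i $ j)"

lemma vector_space_matrix_scale:
  "vector_space (matrix_scale :: 'k::field \<Rightarrow> 'k^'n^'m \<Rightarrow> 'k^'n^'m)"
  by standard (simp_all add: matrix_scale_def vec_eq_iff algebra_simps)

text \<open>The matrix \<open>A + B t\<close> over \<open>K[t]/(t\<^sup>2)\<close>.\<close>

definition matrix_plus_t :: "'k^'n^'m \<Rightarrow> 'k^'n^'m \<Rightarrow> 'k dual_number^'n^'m" where
  "matrix_plus_t A B = (\<chi> i j. Dual (A $ i $ j) (B $ i $ j))"


section \<open>Evolution algebras\<close>

locale based_vector_space = vector_space scale
  for scale :: "'k::field \<Rightarrow> 'v::ab_group_add \<Rightarrow> 'v" +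
  fixes e :: "'i::finite \<Rightarrow> 'v"
  assumes inj_basis: "inj e"
    and independent_basis: "independent (range e)"
    and span_basis: "span (range e) = UNIV"
begin

definition Z2 :: "('v \<Rightarrow> 'v \<Rightarrow> 'v) set" where
  "Z2 = {\<theta>. bilinear_map scale \<theta> \<and> (\<forall>i j. i \<noteq> j \<longrightarrow> \<theta> (e i) (e j) = 0)}"

end

locale evolution_algebra = based_vector_space scale e
  for scale :: "'k::field \<Rightarrow> 'v::ab_group_add \<Rightarrow> 'v" and e :: "'i::finite \<Rightarrow> 'v" +
  fixes mu :: "'v \<Rightarrow> 'v \<Rightarrow> 'v"
  assumes bilinear_mu: "bilinear_map scale mu"
    and mu_basis: "i \<noteq> j \<Longrightarrow> mu (e i) (e j) = 0"
begin

definition delta :: "('v \<Rightarrow> 'v) \<Rightarrow> 'v \<Rightarrow> 'v \<Rightarrow> 'v" where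
  "delta \<phi> u v = \<phi> (mu u v) - mu u (\<phi> v) - mu (\<phi> u) v"

definition B2 :: "('v \<Rightarrow> 'v \<Rightarrow> 'v) set" where
  "B2 = {\<theta> \<in> Z2. \<exists>\<phi>. Vector_Spaces.linear scale scale \<phi> \<and> \<theta> = delta \<phi>}"

definition inf_deformations :: "('v \<times> 'v \<Rightarrow> 'v \<times> 'v \<Rightarrow> 'v \<times> 'v) set" where
  "inf_deformations =
     {\<nu>. bilinear_map (ext_scale scale) \<nu> \<and>
         (\<exists>\<nu>1 \<in> Z2. \<forall>u v. \<nu> (u, 0) (v, 0) = (mu u v, \<nu>1 u v))}"

definition equivalent ::
  "('v \<times> 'v \<Rightarrow> 'v \<times> 'v \<Rightarrow> 'v \<times> 'v) \<Rightarrow> ('v \<times> 'v \<Rightarrow> 'v \<times> 'v \<Rightarrow> 'v \<times> 'v) \<Rightarrow> bool" where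
  "equivalent \<nu> \<nu>' \<longleftrightarrow>
     (\<exists>\<phi>1. Vector_Spaces.linear scale scale \<phi>1 \<and>
       (\<forall>u v. id_plus_t \<phi>1 (\<nu> (u, 0) (v, 0)) =
               \<nu>' (id_plus_t \<phi>1 (u, 0)) (id_plus_t \<phi>1 (v, 0))))"

definition deformations_of_matrices ::
  "('k dual_number^'i^'i) set \<Rightarrow> ('v \<times> 'v \<Rightarrow> 'v \<times> 'v \<Rightarrow> 'v \<times> 'v) set" where
  "deformations_of_matrices S =
     {\<nu> \<in> inf_deformations.
        \<exists>M\<in>S. has_structure_matrix (ext_scale scale) (\<lambda>i. (e i, 0)) \<nu> M}"

text \<open>A set of matrices describes the infinitesimal deformations up to equivalence if its members
  are structure matrices of infinitesimal deformations and every infinitesimal deformation is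
  equivalent to exactly one of these.\<close>

definition is_InfDef :: "('k dual_number^'i^'i) set \<Rightarrow> bool" where
  "is_InfDef S \<longleftrightarrow>
     (\<forall>M\<in>S. \<exists>\<nu>\<in>inf_deformations. has_structure_matrix (ext_scale scale) (\<lambda>i. (e i, 0)) \<nu> M) \<and>
     (\<forall>\<nu>\<in>inf_deformations. \<exists>!\<nu>'. \<nu>' \<in> deformations_of_matrices S \<and> equivalent \<nu> \<nu>')"

definition B2_matrices :: "('k^'i^'i) set" where
  "B2_matrices = {M. \<exists>\<theta>\<in>B2. has_structure_matrix scale e \<theta> M}"

end


section \<open>The identification of \<open>Z2\<close> with matrices\<close>

context based_vector_space
begin

definition coord :: "'v \<Rightarrow> 'i \<Rightarrow> 'k" where
  "coord v i = representation (range e) v (e i)"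

lemma sum_coord: "(\<Sum>i\<in>UNIV. scale (coord v i) (e i)) = v"
proof -
  have "(\<Sum>b\<in>range e. scale (representation (range e) v b) b) = v"
    by (rule sum_representation_eq) (auto simp: independent_basis span_basis)
  then show ?thesis
    by (simp add: sum.reindex[OF inj_basis] coord_def)
qed

lemma coord_add: "coord (u + v) i = coord u i + coord v i"
  by (simp add: coord_def representation_add independent_basis span_basis)

lemma coord_scale: "coord (scale c v) i = c * coord v i"
  by (simp add: coord_def representation_scale independent_basis span_basis)

lemma coord_basis: "coord (e j) i = (if i = j then 1 else 0)"
  using inj_basis by (simp add: coord_def representation_basis independent_basis inj_eq)

lemma coord_sum: "coord (\<Sum>j\<in>A. f j) i = (\<Sum>j\<in>A. coord (f j) i)"
  by (simp add: coord_def representation_sum independent_basis span_basis)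

lemma coord_comb: "coord (\<Sum>j\<in>UNIV. scale (c j) (e j)) i = c i"
  by (simp add: coord_sum coord_scale coord_basis
      if_distrib[of "\<lambda>x. c _ * x"] cong: if_cong)

lemma coord_eqI:
  assumes "\<And>i. coord u i = coord v i"
  shows "u = v"
proof -
  have "(\<Sum>i\<in>UNIV. scale (coord u i) (e i)) = (\<Sum>i\<in>UNIV. scale (coord v i) (e i))"
    by (simp add: assms)
  then show ?thesis
    by (simp add: sum_coord)
qed

lemma has_structure_matrix_iff:
  "has_structure_matrix scale e \<theta> M \<longleftrightarrow> (\<forall>i j. M $ i $ j = coord (\<theta> (e i) (e i)) j)"
proof -
  have "v = (\<Sum>j\<in>UNIV. scale (c j) (e j)) \<longleftrightarrow> (\<forall>j. c j = coord v j)" for v c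
    by (auto simp: coord_comb intro: coord_eqI)
  then show ?thesis
    by (simp add: has_structure_matrix_def)
qed

lemma ex1_structure_matrix: "\<exists>!M. has_structure_matrix scale e \<theta> M"
proof
  show "has_structure_matrix scale e \<theta> (\<chi> i j. coord (\<theta> (e i) (e i)) j)"
    by (simp add: has_structure_matrix_iff)
qed (simp add: has_structure_matrix_iff vec_eq_iff)

lemma Z2_apply:
  assumes "\<theta> \<in> Z2" and "has_structure_matrix scale e \<theta> M"
  shows "\<theta> u v = (\<Sum>i\<in>UNIV. \<Sum>j\<in>UNIV. scale (coord u i * coord v i * M $ i $ j) (e j))"
proof -
  have bil: "module_hom scale scale (\<theta> x)" "module_hom scale scale (\<lambda>x. \<theta> x y)" for x y
    using assms(1) by (auto simp: Z2_def bilinear_map_def)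
  have "\<theta> u v = \<theta> (\<Sum>i\<in>UNIV. scale (coord u i) (e i)) v"
    by (simp add: sum_coord)
  also have "\<dots> = (\<Sum>i\<in>UNIV. scale (coord u i) (\<theta> (e i) v))"
    by (simp add: module_hom.sum[OF bil(2)] module_hom.scale[OF bil(2)])
  also have "\<dots> =
      (\<Sum>i\<in>UNIV. scale (coord u i) (\<theta> (e i) (\<Sum>j\<in>UNIV. scale (coord v j) (e j))))"
    by (simp add: sum_coord)
  also have "\<dots> = (\<Sum>i\<in>UNIV. scale (coord u i) (\<Sum>j\<in>UNIV. scale (coord v j) (\<theta> (e i) (e j))))"
    by (simp add: module_hom.sum[OF bil(1)] module_hom.scale[OF bil(1)])
  also have "\<dots> = (\<Sum>i\<in>UNIV. scale (coord u i) (scale (coord v i) (\<theta> (e i) (e i))))"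
  proof (rule sum.cong)
    fix i
    have "(\<Sum>j\<in>UNIV. scale (coord v j) (\<theta> (e i) (e j))) =
        (\<Sum>j\<in>UNIV. if j = i then scale (coord v i) (\<theta> (e i) (e i)) else 0)"
      using assms(1) by (intro sum.cong) (auto simp: Z2_def)
    then show "scale (coord u i) (\<Sum>j\<in>UNIV. scale (coord v j) (\<theta> (e i) (e j))) =
        scale (coord u i) (scale (coord v i) (\<theta> (e i) (e i)))"
      by simp
  qed simp
  also have "\<dots> = (\<Sum>i\<in>UNIV. \<Sum>j\<in>UNIV. scale (coord u i * coord v i * M $ i $ j) (e j))"
    using assms(2) by (simp add: has_structure_matrix_def scale_sum_right mult.assoc)
  finally show ?thesis .
qed

lemma ex1_Z2: "\<exists>!\<theta>. \<theta> \<in> Z2 \<and> has_structure_matrix scale e \<theta> M"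
proof
  let ?f = "\<lambda>u v. \<Sum>i\<in>UNIV. \<Sum>j\<in>UNIV. scale (coord u i * coord v i * M $ i $ j) (e j)"
  have mod: "module scale" ..
  have "bilinear_map scale ?f"
    unfolding bilinear_map_def module_hom_def module_hom_axioms_def
    by (auto simp: mod coord_add coord_scale ring_distribs scale_left_distrib sum.distrib
        scale_sum_right mult_ac)
  moreover have "?f (e i) (e j) = 0" if "i \<noteq> j" for i j
    using that by (intro sum.neutral ballI) (auto simp: coord_basis)
  moreover have "?f (e i) (e i) = (\<Sum>j\<in>UNIV. scale (M $ i $ j) (e j))" for i
  proof -
    have "?f (e i) (e i) =
        (\<Sum>k\<in>UNIV. if k = i then (\<Sum>j\<in>UNIV. scale (M $ i $ j) (e j)) else 0)"
      by (intro sum.cong) (auto simp: coord_basis)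
    then show ?thesis by simp
  qed
  ultimately show "?f \<in> Z2 \<and> has_structure_matrix scale e ?f M"
    by (auto simp: Z2_def has_structure_matrix_def)
next
  fix \<theta> assume "\<theta> \<in> Z2 \<and> has_structure_matrix scale e \<theta> M"
  then show "\<theta> = (\<lambda>u v. \<Sum>i\<in>UNIV. \<Sum>j\<in>UNIV. scale (coord u i * coord v i * M $ i $ j) (e j))"
    using Z2_apply by blast
qed

end

end

theory Submission
  imports Defs
begin

text \<open>An infinitesimal deformation is \<open>\<mu> + t \<theta>\<close> for a unique \<open>\<theta> \<in> Z\<^sup>2\<close>, and comparing coefficients
  of \<open>t\<close> shows that \<open>\<mu> + t \<theta>\<close> and \<open>\<mu> + t \<theta>'\<close> are equivalent iff \<open>\<theta>' - \<theta> \<in> B\<^sup>2\<close>. Hence a set of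
  matrices describes the deformations up to equivalence as soon as its \<open>t\<close>-parts form a system of
  representatives of all matrices modulo the coboundaries. If \<open>A\<close> is the structure matrix of \<open>\<mu>\<close> and
  row \<open>i\<close> of \<open>F\<close> contains the coordinates of \<open>\<phi>(e\<^sub>i)\<close>, then the coefficients of
  \<open>\<delta>\<phi>(e\<^sub>i, e\<^sub>i)\<close> are row \<open>i\<close> of \<open>A F - 2 diag(F) A\<close>, and \<open>\<delta>\<phi>\<close> lies in \<open>Z\<^sup>2\<close> iff
  \<open>F\<^sub>j\<^sub>i e\<^sub>i\<^sup>2 + F\<^sub>i\<^sub>j e\<^sub>j\<^sup>2 = 0\<close> for \<open>i \<noteq> j\<close>. In dimension two each \<open>B\<^sup>2\<close> thus becomes the solution set of
  explicit linear equations on the entries.\<close>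

section \<open>Deformations and coboundaries in arbitrary dimension\<close>

context based_vector_space
begin

lemma bilinear_map_simps:
  assumes "bilinear_map scale f"
  shows "f (u + u') v = f u v + f u' v" and "f u (v + v') = f u v + f u v'"
    and "f (scale c u) v = scale c (f u v)" and "f u (scale c v) = scale c (f u v)"
    and "f 0 v = 0" and "f u 0 = 0"
proof -
  have left: "module_hom scale scale (\<lambda>x. f x v)" and right: "module_hom scale scale (f u)" for u v
    using assms by (auto simp: bilinear_map_def)
  show "f (u + u') v = f u v + f u' v" "f u (v + v') = f u v + f u v'"
    "f (scale c u) v = scale c (f u v)" "f u (scale c v) = scale c (f u v)"
    "f 0 v = 0" "f u 0 = 0"
    using module_hom.add[OF left] module_hom.add[OF right] module_hom.scale[OF left]
      module_hom.scale[OF right] module_hom.zero[OF left] module_hom.zero[OF right]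
    by auto
qed

lemma bilinear_mapI:
  assumes "\<And>u u' v. f (u + u') v = f u v + f u' v" and "\<And>u v v'. f u (v + v') = f u v + f u v'"
    and "\<And>c u v. f (scale c u) v = scale c (f u v)" and "\<And>c u v. f u (scale c v) = scale c (f u v)"
  shows "bilinear_map scale f"
  using assms module_axioms
  unfolding bilinear_map_def module_hom_def module_hom_axioms_def by auto

lemma Z2_diff:
  assumes "\<theta> \<in> Z2" and "\<theta>' \<in> Z2"
  shows "(\<lambda>u v. \<theta>' u v - \<theta> u v) \<in> Z2"
proof -
  have "bilinear_map scale \<theta>" "bilinear_map scale \<theta>'"
    using assms by (auto simp: Z2_def)
  then have "bilinear_map scale (\<lambda>u v. \<theta>' u v - \<theta> u v)"
    by (intro bilinear_mapI) (simp_all add: bilinear_map_simps scale_right_diff_distrib)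
  then show ?thesis
    using assms by (auto simp: Z2_def)
qed

lemma coord_diff: "coord (u - v) i = coord u i - coord v i"
  using coord_add[of "u - v" v i] by simp

lemma coord_zero: "coord 0 i = 0"
  using coord_scale[of 0 0 i] by simp

lemma coord_minus: "coord (- v) i = - coord v i"
  using coord_diff[of 0 v i] by (simp add: coord_zero)

lemma has_structure_matrix_diff:
  assumes "has_structure_matrix scale e \<theta> X" and "has_structure_matrix scale e \<theta>' X'"
  shows "has_structure_matrix scale e (\<lambda>u v. \<theta>' u v - \<theta> u v) (X' - X)"
  using assms by (simp add: has_structure_matrix_iff coord_diff)

end

section \<open>Deformations, their equivalence and their matrices\<close>

context evolution_algebra
begin

text \<open>With \<open>x = u + t u'\<close> and \<open>y = v + t v'\<close> this is
  \<open>mu + t \<theta>\<close> expanded modulo \<open>t^2\<close>: the term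
  \<open>mu u' v'\<close> disappears, and \<open>\<theta>\<close>, already multiplied by
  \<open>t\<close>, sees only constant parts.\<close>

definition deform :: "('v \<Rightarrow> 'v \<Rightarrow> 'v) \<Rightarrow> 'v \<times> 'v \<Rightarrow> 'v \<times> 'v \<Rightarrow> 'v \<times> 'v" where
  "deform \<theta> x y =
     (mu (fst x) (fst y), mu (fst x) (snd y) + mu (snd x) (fst y) + \<theta> (fst x) (fst y))"

lemmas mu_simps = bilinear_map_simps[OF bilinear_mu]

text \<open>Every vector of the extension is \<open>u + t u'\<close> with constant \<open>u\<close>,
  \<open>u'\<close>, so bilinearity over the dual numbers recovers the whole product from its values
  on constant vectors.\<close>

lemma inf_deformations_eq: "inf_deformations = deform ` Z2"
proof (intro equalityI subsetI)
  fix \<nu> assume "\<nu> \<in> inf_deformations"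
  then obtain \<theta> where bil: "bilinear_map (ext_scale scale) \<nu>" and \<theta>: "\<theta> \<in> Z2"
    and \<nu>: "\<And>u v. \<nu> (u, 0) (v, 0) = (mu u v, \<theta> u v)"
    by (auto simp: inf_deformations_def)
  have left: "module_hom (ext_scale scale) (ext_scale scale) (\<lambda>x. \<nu> x y)"
    and right: "module_hom (ext_scale scale) (ext_scale scale) (\<nu> x)" for x y
    using bil unfolding bilinear_map_def by blast+
  \<comment> \<open>Multiplication by \<open>t\<close>, sending \<open>(v, w)\<close> to
    \<open>(0, v)\<close>.\<close>
  let ?t = "ext_scale scale (Dual 0 1)"
  have split: "(u, v) = (u, 0) + ?t (v, 0)" for u v
    by (simp add: ext_scale_def)
  have "\<nu> (u, u') (v, v') = deform \<theta> (u, u') (v, v')" for u u' v v'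
  proof -
    \<comment> \<open>The nested \<open>?t\<close> is multiplication by \<open>t^2\<close>, which is
      zero, so the last product drops out.\<close>
    have "\<nu> (u, u') (v, v') = \<nu> (u, 0) (v, 0) + ?t (\<nu> (u', 0) (v, 0)) +
        ?t (\<nu> (u, 0) (v', 0) + ?t (\<nu> (u', 0) (v', 0)))"
      unfolding split[of u u'] split[of v v']
      by (simp only: module_hom.add[OF left] module_hom.add[OF right]
          module_hom.scale[OF left] module_hom.scale[OF right])
    then show ?thesis
      by (simp add: \<nu> ext_scale_def deform_def algebra_simps)
  qed
  then have "\<nu> = deform \<theta>" by (intro ext) (metis surj_pair)
  then show "\<nu> \<in> deform ` Z2" using \<theta> by blast
next
  fix \<nu> assume "\<nu> \<in> deform ` Z2"
  then obtain \<theta> where \<theta>: "\<theta> \<in> Z2" and \<nu>: "\<nu> = deform \<theta>" by blast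
  then have bil: "bilinear_map scale \<theta>" by (simp add: Z2_def)
  have "bilinear_map (ext_scale scale) (deform \<theta>)"
    using module_ext_scale[OF module_axioms]
    unfolding bilinear_map_def module_hom_def module_hom_axioms_def
    by (auto simp: deform_def ext_scale_def mu_simps bilinear_map_simps[OF bil]
        scale_right_distrib add_ac mult.commute)
  then show "\<nu> \<in> inf_deformations"
    using \<theta> by (auto simp: inf_deformations_def \<nu> deform_def mu_simps)
qed

text \<open>On constant vectors both sides have constant part \<open>mu u v\<close>. The
  \<open>t\<close>-parts are \<open>\<theta> u v + \<phi> (mu u v)\<close> and
  \<open>mu u (\<phi> v) + mu (\<phi> u) v + \<theta>' u v\<close>, which agree exactly when
  \<open>\<theta>' - \<theta> = delta \<phi>\<close>.\<close>

lemma equivalent_deform_iff: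
  assumes "\<theta> \<in> Z2" and "\<theta>' \<in> Z2"
  shows "equivalent (deform \<theta>) (deform \<theta>') \<longleftrightarrow> (\<lambda>u v. \<theta>' u v - \<theta> u v) \<in> B2"
proof -
  have "id_plus_t \<phi> (deform \<theta> (u, 0) (v, 0)) =
      deform \<theta>' (id_plus_t \<phi> (u, 0)) (id_plus_t \<phi> (v, 0)) \<longleftrightarrow>
      \<theta>' u v - \<theta> u v = delta \<phi> u v" for \<phi> u v
    by (auto simp: id_plus_t_def deform_def delta_def mu_simps algebra_simps)
  then show ?thesis
    using Z2_diff[OF assms] by (simp add: equivalent_def B2_def fun_eq_iff)
qed

lemma diff_in_B2_iff:
  assumes "\<theta> \<in> Z2" "has_structure_matrix scale e \<theta> X"
    and "\<theta>' \<in> Z2" "has_structure_matrix scale e \<theta>' X'"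
  shows "(\<lambda>u v. \<theta>' u v - \<theta> u v) \<in> B2 \<longleftrightarrow> X' - X \<in> B2_matrices"
proof
  assume "(\<lambda>u v. \<theta>' u v - \<theta> u v) \<in> B2"
  then show "X' - X \<in> B2_matrices"
    using has_structure_matrix_diff[OF assms(2,4)] by (auto simp: B2_matrices_def)
next
  assume "X' - X \<in> B2_matrices"
  then obtain \<eta> where "\<eta> \<in> B2" "has_structure_matrix scale e \<eta> (X' - X)"
    by (auto simp: B2_matrices_def)
  \<comment> \<open>Elements of \<open>Z2\<close> are determined by their matrices, so a coboundary
    with matrix \<open>X' - X\<close> is the difference itself.\<close>
  moreover from this have "\<eta> = (\<lambda>u v. \<theta>' u v - \<theta> u v)"
    using ex1_Z2[of "X' - X"] has_structure_matrix_diff[OF assms(2,4)] Z2_diff[OF assms(1,3)]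
    by (auto simp: B2_def)
  ultimately show "(\<lambda>u v. \<theta>' u v - \<theta> u v) \<in> B2" by simp
qed

text \<open>Scaling \<open>(e j, 0)\<close> by \<open>Dual a b\<close> gives
  \<open>(scale a (e j), scale b (e j))\<close>, so the constant part and the \<open>t\<close>-part
  of \<open>P\<close> can be read off separately, as matrices of \<open>mu\<close> and
  \<open>\<theta>\<close>.\<close>

lemma structure_matrix_deform_iff:
  assumes "has_structure_matrix scale e mu A" and "\<theta> \<in> Z2"
  shows "has_structure_matrix (ext_scale scale) (\<lambda>i. (e i, 0)) (deform \<theta>) P \<longleftrightarrow>
    (\<exists>N. P = matrix_plus_t A N \<and> has_structure_matrix scale e \<theta> N)"
proof -
  have sum_pair: "(\<Sum>j\<in>J. (f j, g j)) = (sum f J, sum g J)"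
    for f g :: "'i \<Rightarrow> 'v" and J
    by (induction J rule: infinite_finite_induct) (auto simp: zero_prod_def)
  have P: "P = matrix_plus_t A N \<longleftrightarrow>
      (\<chi> i j. dconst (P $ i $ j)) = A \<and> (\<chi> i j. dlin (P $ i $ j)) = N" for N
    by (auto simp: matrix_plus_t_def vec_eq_iff dual_number.expand)
  have "has_structure_matrix (ext_scale scale) (\<lambda>i. (e i, 0)) (deform \<theta>) P \<longleftrightarrow>
      has_structure_matrix scale e mu (\<chi> i j. dconst (P $ i $ j)) \<and>
      has_structure_matrix scale e \<theta> (\<chi> i j. dlin (P $ i $ j))"
    by (auto simp: has_structure_matrix_def deform_def ext_scale_def mu_simps sum_pair)
  \<comment> \<open>\<open>mu\<close> has only one structure matrix, which pins the constant part of
    \<open>P\<close> to \<open>A\<close>.\<close>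
  then show ?thesis
    unfolding P using ex1_structure_matrix[of mu] assms(1) by blast
qed

text \<open>The second assumption says that the set \<open>C\<close> meets every coset of the
  coboundary matrices exactly once; these cosets correspond to the equivalence classes of
  deformations.\<close>

lemma is_InfDefI:
  assumes A: "has_structure_matrix scale e mu A"
    and C: "\<And>X. \<exists>!N. N \<in> C \<and> N - X \<in> B2_matrices"
  shows "is_InfDef (matrix_plus_t A ` C)"
proof -
  have matrix_plus_t_inj: "matrix_plus_t A N = matrix_plus_t A N' \<longleftrightarrow> N = N'" for N N'
    by (auto simp: matrix_plus_t_def vec_eq_iff)
  have mem: "deform \<theta> \<in> deformations_of_matrices (matrix_plus_t A ` C) \<longleftrightarrow>
      (\<exists>N\<in>C. has_structure_matrix scale e \<theta> N)" if "\<theta> \<in> Z2" for \<theta>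
    using that
    by (auto simp: deformations_of_matrices_def inf_deformations_eq matrix_plus_t_inj
        structure_matrix_deform_iff[OF A])
  have "\<exists>\<nu>\<in>inf_deformations.
      has_structure_matrix (ext_scale scale) (\<lambda>i. (e i, 0)) \<nu> (matrix_plus_t A N)" for N
    using ex1_Z2[of N] structure_matrix_deform_iff[OF A] by (auto simp: inf_deformations_eq)
  moreover have "\<exists>!\<nu>'. \<nu>' \<in> deformations_of_matrices (matrix_plus_t A ` C) \<and> equivalent \<nu> \<nu>'"
    if "\<nu> \<in> inf_deformations" for \<nu>
  proof -
    from that obtain \<theta> where \<theta>: "\<theta> \<in> Z2" and \<nu>: "\<nu> = deform \<theta>"
      by (auto simp: inf_deformations_eq)
    obtain X where X: "has_structure_matrix scale e \<theta> X"
      using ex1_structure_matrix by blast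
    obtain N where N: "N \<in> C" "N - X \<in> B2_matrices" using C by blast
    obtain \<theta>' where \<theta>': "\<theta>' \<in> Z2" "has_structure_matrix scale e \<theta>' N" using ex1_Z2 by blast
    show ?thesis
    proof (rule ex1I[of _ "deform \<theta>'"])
      show "deform \<theta>' \<in> deformations_of_matrices (matrix_plus_t A ` C) \<and>
          equivalent \<nu> (deform \<theta>')"
        using N \<theta> \<theta>' X by (auto simp: mem \<nu> equivalent_deform_iff diff_in_B2_iff)
    next
      fix \<nu>' assume \<nu>': "\<nu>' \<in> deformations_of_matrices (matrix_plus_t A ` C) \<and> equivalent \<nu> \<nu>'"
      then obtain \<eta> where \<eta>: "\<eta> \<in> Z2" "\<nu>' = deform \<eta>"
        by (auto simp: deformations_of_matrices_def inf_deformations_eq)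
      with \<nu>' obtain N' where N': "N' \<in> C" "has_structure_matrix scale e \<eta> N'"
        using mem by blast
      then have "N' - X \<in> B2_matrices"
        using \<nu>' \<theta> X \<eta> by (auto simp: \<nu> equivalent_deform_iff diff_in_B2_iff)
      \<comment> \<open>Uniqueness concerns the product \<open>\<nu>'\<close>, not its matrix: first
        the representatives agree, then the maps in \<open>Z2\<close> with that matrix.\<close>
      with N N' C have "N' = N" by blast
      with N' \<eta> \<theta>' have "\<eta> = \<theta>'" using ex1_Z2[of N] by blast
      with \<eta> show "\<nu>' = deform \<theta>'" by simp
    qed
  qed
  ultimately show ?thesis by (auto simp: is_InfDef_def)
qed

section \<open>Coboundaries as matrices\<close>

text \<open>Since \<open>mu (e i) v\<close> sees only the \<open>e i\<close>-coordinate of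
  \<open>v\<close>, both \<open>mu (e i) (\<phi> (e i))\<close> and
  \<open>mu (\<phi> (e i)) (e i)\<close> are \<open>F $ i $ i\<close> times the square of
  \<open>e i\<close>; hence the factor 2. The first conjunct restricts \<open>F\<close> because
  \<open>delta \<phi>\<close> need not vanish on distinct basis vectors.\<close>

lemma B2_matrices_iff:
  assumes A: "has_structure_matrix scale e mu A"
  shows "X \<in> B2_matrices \<longleftrightarrow>
    (\<exists>F. (\<forall>i j k. i \<noteq> j \<longrightarrow> F $ j $ i * A $ i $ k + F $ i $ j * A $ j $ k = 0) \<and>
      X = (\<chi> i k. (\<Sum>j\<in>UNIV. A $ i $ j * F $ j $ k) - 2 * F $ i $ i * A $ i $ k))"
    (is "_ \<longleftrightarrow> (\<exists>F. ?cocycle F \<and> X = ?D F)")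
proof -
  have "mu \<in> Z2" using bilinear_mu mu_basis by (simp add: Z2_def)
  note mu_apply = Z2_apply[OF this A]
  \<comment> \<open>\<open>coord (e i) l\<close> is zero for \<open>l \<noteq> i\<close>; the
    \<open>if\<close> form lets the outer sum collapse to one term.\<close>
  have "mu (e i) v = (\<Sum>l\<in>UNIV. if l = i then (\<Sum>j\<in>UNIV. scale (coord v i * A $ i $ j) (e j)) else 0)"
    "mu v (e i) = (\<Sum>l\<in>UNIV. if l = i then (\<Sum>j\<in>UNIV. scale (coord v i * A $ i $ j) (e j)) else 0)"
    for i v
    unfolding mu_apply by (rule sum.cong; auto simp: coord_basis)+
  then have coord_mu: "coord (mu (e i) v) k = coord v i * A $ i $ k"
    "coord (mu v (e i)) k = coord v i * A $ i $ k" for i k v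
    by (simp_all add: coord_comb)
  have delta_bilinear: "bilinear_map scale (delta \<phi>)" if "Vector_Spaces.linear scale scale \<phi>" for \<phi>
  proof -
    interpret \<phi>: Vector_Spaces.linear scale scale \<phi> by fact
    show ?thesis
      by (intro bilinear_mapI)
        (simp_all add: delta_def mu_simps \<phi>.add \<phi>.scale scale_right_diff_distrib)
  qed
  have off_diagonal: "coord (delta \<phi> (e i) (e j)) k =
      - (coord (\<phi> (e j)) i * A $ i $ k + coord (\<phi> (e i)) j * A $ j $ k)"
    if "Vector_Spaces.linear scale scale \<phi>" "i \<noteq> j" for \<phi> i j k
  proof -
    interpret \<phi>: Vector_Spaces.linear scale scale \<phi> by fact
    show ?thesis
      using that(2) by (simp add: delta_def mu_basis coord_diff coord_minus
          coord_zero coord_mu \<phi>.zero)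
  qed
  have diagonal: "coord (delta \<phi> (e i) (e i)) k = ?D (\<chi> i j. coord (\<phi> (e i)) j) $ i $ k"
    if "Vector_Spaces.linear scale scale \<phi>" for \<phi> i k
  proof -
    interpret \<phi>: Vector_Spaces.linear scale scale \<phi> by fact
    have "\<phi> (mu (e i) (e i)) = (\<Sum>j\<in>UNIV. scale (A $ i $ j) (\<phi> (e j)))"
      using A by (simp add: has_structure_matrix_def \<phi>.sum \<phi>.scale)
    then show ?thesis
      by (simp add: delta_def coord_diff coord_mu coord_sum coord_scale)
  qed
  have delta_matrix: "delta \<phi> \<in> B2 \<longleftrightarrow> ?cocycle (\<chi> i j. coord (\<phi> (e i)) j)"
    "has_structure_matrix scale e (delta \<phi>) X \<longleftrightarrow> X = ?D (\<chi> i j. coord (\<phi> (e i)) j)"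
    if lin: "Vector_Spaces.linear scale scale \<phi>" for \<phi> X
  proof -
    have zero_iff: "v = 0 \<longleftrightarrow> (\<forall>k. coord v k = 0)" for v
      by (auto simp: coord_zero intro: coord_eqI)
    have "delta \<phi> \<in> B2 \<longleftrightarrow> (\<forall>i j. i \<noteq> j \<longrightarrow> delta \<phi> (e i) (e j) = 0)"
      using lin delta_bilinear by (auto simp: B2_def Z2_def)
    also have "\<dots> \<longleftrightarrow> ?cocycle (\<chi> i j. coord (\<phi> (e i)) j)"
      by (auto simp: zero_iff off_diagonal[OF lin] neg_eq_iff_add_eq_0)
    finally show "delta \<phi> \<in> B2 \<longleftrightarrow> ?cocycle (\<chi> i j. coord (\<phi> (e i)) j)" .
    show "has_structure_matrix scale e (delta \<phi>) X \<longleftrightarrow> X = ?D (\<chi> i j. coord (\<phi> (e i)) j)"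
      by (auto simp: has_structure_matrix_iff diagonal[OF lin] vec_eq_iff)
  qed
  show ?thesis
  proof
    assume "X \<in> B2_matrices"
    then obtain \<phi> where lin: "Vector_Spaces.linear scale scale \<phi>" and \<phi>: "delta \<phi> \<in> B2"
      "has_structure_matrix scale e (delta \<phi>) X"
      by (auto simp: B2_matrices_def B2_def)
    have "?cocycle (\<chi> i j. coord (\<phi> (e i)) j) \<and> X = ?D (\<chi> i j. coord (\<phi> (e i)) j)"
      by (intro conjI iffD1[OF delta_matrix(1)[OF lin] \<phi>(1)] iffD1[OF delta_matrix(2)[OF lin] \<phi>(2)])
    then show "\<exists>F. ?cocycle F \<and> X = ?D F" by (rule exI)
  next
    assume "\<exists>F. ?cocycle F \<and> X = ?D F"
    then obtain F where F: "?cocycle F" "X = ?D F" by blast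
    \<comment> \<open>The linear map sending \<open>e i\<close> to the vector with coordinates in
      row \<open>i\<close> of \<open>F\<close>.\<close>
    define \<phi> where "\<phi> v = (\<Sum>i\<in>UNIV. \<Sum>j\<in>UNIV. scale (coord v i * F $ i $ j) (e j))" for v
    have "\<phi> (u + v) = \<phi> u + \<phi> v" for u v
      by (simp add: \<phi>_def coord_add distrib_right scale_left_distrib sum.distrib)
    moreover have "\<phi> (scale c v) = scale c (\<phi> v)" for c v
      by (simp add: \<phi>_def coord_scale scale_sum_right mult.assoc)
    ultimately have lin: "Vector_Spaces.linear scale scale \<phi>"
      using vector_space_axioms by (simp add: Vector_Spaces.linear_iff)
    have "\<phi> (e i) = (\<Sum>l\<in>UNIV. if l = i then (\<Sum>j\<in>UNIV. scale (F $ i $ j) (e j)) else 0)" for i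
      unfolding \<phi>_def by (intro sum.cong) (auto simp: coord_basis)
    then have "(\<chi> i j. coord (\<phi> (e i)) j) = F"
      by (simp add: coord_comb vec_eq_iff)
    then show "X \<in> B2_matrices"
      using delta_matrix[OF lin] F unfolding B2_matrices_def by auto
  qed
qed

end

section \<open>Dimension two\<close>

text \<open>Being a mere input abbreviation, it keeps the lemmas below literally about the nested
  vectors of the theorem.\<close>

abbreviation (input) mat2 :: "'a::zero \<Rightarrow> 'a \<Rightarrow> 'a \<Rightarrow> 'a \<Rightarrow> 'a^2^2" where
  "mat2 a b c d \<equiv> vector [vector [a, b], vector [c, d]]"

lemma mat2_eq_iff: "mat2 a b c d = mat2 a' b' c' d' \<longleftrightarrow> a = a' \<and> b = b' \<and> c = c' \<and> d = d'"
  by (auto simp: vec_eq_iff forall_2)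

lemma mat2_cases: obtains a b c d where "X = mat2 a b c d"
proof
  show "X = mat2 (X $ 1 $ 1) (X $ 1 $ 2) (X $ 2 $ 1) (X $ 2 $ 2)"
    by (simp add: vec_eq_iff forall_2)
qed

lemma mat2_diff:
  "mat2 a b c d - mat2 a' b' c' d' =
    (mat2 (a - a') (b - b') (c - c') (d - d') :: 'a::ab_group_add^2^2)"
  by (simp add: vec_eq_iff forall_2)

lemma matrix_scale_mat2:
  "matrix_scale k (mat2 a b c d) = (mat2 (k * a) (k * b) (k * c) (k * d) :: 'a::field^2^2)"
  by (simp add: vec_eq_iff forall_2 matrix_scale_def)

lemma zero_mat2: "(0 :: 'a::zero^2^2) = mat2 0 0 0 0"
  by (simp add: vec_eq_iff forall_2)

lemma mat2_set_eqI:
  assumes "\<And>p q r s. mat2 p q r s \<in> S \<longleftrightarrow> mat2 p q r s \<in> T"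
  shows "S = T"
  using assms mat2_cases by (metis subsetI subset_antisym)

text \<open>Splitting off one generator at a time turns membership in the span of an explicit list
  into solvability of four scalar equations in the coefficients.\<close>

lemma mat2_in_span_iff:
  fixes S :: "('a::field^2^2) set"
  shows "mat2 p q r s \<in> module.span matrix_scale (insert (mat2 a b c d) S) \<longleftrightarrow>
    (\<exists>k. mat2 (p - k * a) (q - k * b) (r - k * c) (s - k * d) \<in> module.span matrix_scale S)"
    and "mat2 p q r s \<in> module.span matrix_scale ({} :: ('a^2^2) set) \<longleftrightarrow>
      p = 0 \<and> q = 0 \<and> r = 0 \<and> s = 0"
proof -
  interpret vector_space "matrix_scale :: 'a \<Rightarrow> 'a^2^2 \<Rightarrow> 'a^2^2"
    by (rule vector_space_matrix_scale)
  show "mat2 p q r s \<in> module.span matrix_scale (insert (mat2 a b c d) S) \<longleftrightarrow>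
    (\<exists>k. mat2 (p - k * a) (q - k * b) (r - k * c) (s - k * d) \<in> module.span matrix_scale S)"
    by (simp add: span_breakdown_eq mat2_diff matrix_scale_mat2)
  show "mat2 p q r s \<in> module.span matrix_scale ({} :: ('a^2^2) set) \<longleftrightarrow>
      p = 0 \<and> q = 0 \<and> r = 0 \<and> s = 0"
    by (simp add: zero_mat2 mat2_eq_iff)
qed

section \<open>Coboundaries of two-dimensional algebras\<close>

text \<open>Characteristic zero permits the divisions by 2 and 3 in the witnesses below.\<close>

locale evolution_algebra_2 = evolution_algebra scale e mu
  for scale :: "'k::field_char_0 \<Rightarrow> 'v::ab_group_add \<Rightarrow> 'v"
    and e :: "2 \<Rightarrow> 'v" and mu :: "'v \<Rightarrow> 'v \<Rightarrow> 'v"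
begin

lemma structure_matrix_mat2:
  assumes "mu (e 1) (e 1) = scale a (e 1) + scale b (e 2)"
    and "mu (e 2) (e 2) = scale c (e 1) + scale d (e 2)"
  shows "has_structure_matrix scale e mu (mat2 a b c d)"
  using assms by (simp add: has_structure_matrix_def forall_2 sum_2)

text \<open>The witness \<open>mat2 x y z w\<close> is the matrix of a \<open>\<phi>\<close> with \<open>\<delta>\<phi>\<close> given by \<open>mat2 p q r s\<close>.\<close>

lemma mat2_in_B2_iff:
  assumes "has_structure_matrix scale e mu (mat2 a b c d)"
  shows "mat2 p q r s \<in> B2_matrices \<longleftrightarrow>
    (\<exists>x y z w. z * a + y * c = 0 \<and> z * b + y * d = 0 \<and>
      p = b * z - a * x \<and> q = a * y + b * w - 2 * x * b \<and>
      r = c * x + d * z - 2 * w * c \<and> s = c * y - d * w)"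
    (is "_ \<longleftrightarrow> ?R")
proof -
  \<comment> \<open>The condition off the diagonal is symmetric in \<open>i\<close> and
    \<open>j\<close>, so one pair gives both equations. On the diagonal of \<open>X\<close> the
    factor 2 merges with the first sum, as in
    \<open>a * x + b * z - 2 * x * a = b * z - a * x\<close>.\<close>
  have B2: "mat2 p q r s \<in> B2_matrices \<longleftrightarrow>
     (\<exists>F :: 'k^2^2. F $ 2 $ 1 * a + F $ 1 $ 2 * c = 0 \<and> F $ 2 $ 1 * b + F $ 1 $ 2 * d = 0 \<and>
      p = b * F $ 2 $ 1 - a * F $ 1 $ 1 \<and>
      q = a * F $ 1 $ 2 + b * F $ 2 $ 2 - 2 * F $ 1 $ 1 * b \<and>
      r = c * F $ 1 $ 1 + d * F $ 2 $ 1 - 2 * F $ 2 $ 2 * c \<and>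
      s = c * F $ 1 $ 2 - d * F $ 2 $ 2)"
    unfolding B2_matrices_iff[OF assms]
    by (rule arg_cong[where f = Ex])
      (auto simp: fun_eq_iff vec_eq_iff forall_2 sum_2 algebra_simps)
  show ?thesis
  proof
    assume "mat2 p q r s \<in> B2_matrices"
    then show ?R unfolding B2 by blast
  next
    assume ?R
    then obtain x y z w where "z * a + y * c = 0 \<and> z * b + y * d = 0 \<and>
      p = b * z - a * x \<and> q = a * y + b * w - 2 * x * b \<and>
      r = c * x + d * z - 2 * w * c \<and> s = c * y - d * w" by blast
    then show "mat2 p q r s \<in> B2_matrices"
      unfolding B2 by (intro exI[of _ "mat2 x y z w"]) simp
  qed
qed

lemma is_InfDef_mat2I:
  assumes "has_structure_matrix scale e mu (mat2 a b c d)"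
    and "\<And>p q r s. \<exists>!N. N \<in> C \<and> N - mat2 p q r s \<in> B2_matrices"
  shows "is_InfDef (matrix_plus_t (mat2 a b c d) ` C)"
proof (rule is_InfDefI[OF assms(1)])
  fix X :: "'k^2^2"
  obtain p q r s where "X = mat2 p q r s" by (rule mat2_cases)
  then show "\<exists>!N. N \<in> C \<and> N - X \<in> B2_matrices"
    using assms(2)[of p q r s] by simp
qed

section \<open>The six families\<close>

text \<open>The off-diagonal condition forces \<open>z = 0\<close>; then \<open>p = - x\<close> and
  \<open>q = y\<close> are free and the bottom row vanishes, so the bottom row is a complete
  invariant.\<close>

lemma B2_and_InfDef_E1:
  assumes "mu (e 1) (e 1) = e 1" and "mu (e 2) (e 2) = 0"
  shows "B2_matrices = module.span matrix_scale {mat2 1 0 0 0, mat2 0 1 0 0}"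
    and "is_InfDef {matrix_plus_t (mat2 1 0 0 0) (mat2 0 0 \<alpha> \<beta>) | \<alpha> \<beta>. True}"
proof -
  have A: "has_structure_matrix scale e mu (mat2 1 0 0 0)"
    using assms by (intro structure_matrix_mat2) simp_all
  have B2: "mat2 p q r s \<in> B2_matrices \<longleftrightarrow> r = 0 \<and> s = 0" for p q r s
    unfolding mat2_in_B2_iff[OF A]
    by (rule iffI, force simp: algebra_simps,
        rule exI[of _ "- p"], rule exI[of _ q], rule exI[of _ 0], rule exI[of _ 0],
        simp add: field_simps)
  have "mat2 p q r s \<in> B2_matrices \<longleftrightarrow> mat2 p q r s \<in> module.span matrix_scale
      {mat2 1 0 0 0, mat2 0 1 0 0}" for p q r s
    unfolding B2 mat2_in_span_iff
    by (rule iffI, rule exI[of _ p], rule exI[of _ q], simp add: field_simps,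
        force simp: algebra_simps)
  then show "B2_matrices = module.span matrix_scale {mat2 1 0 0 0, mat2 0 1 0 0}"
    by (rule mat2_set_eqI)
  have "\<exists>!N. N \<in> {mat2 0 0 \<alpha> \<beta> | \<alpha> \<beta>. True} \<and> N - mat2 p q r s \<in> B2_matrices" for p q r s
    by (rule ex1I[of _ "mat2 0 0 r s"], rule conjI, blast,
        simp add: mat2_diff B2 field_simps, auto simp: mat2_diff B2 mat2_eq_iff field_simps)
  from is_InfDef_mat2I[OF A this]
  show "is_InfDef {matrix_plus_t (mat2 1 0 0 0) (mat2 0 0 \<alpha> \<beta>) | \<alpha> \<beta>. True}"
    by (rule back_subst[of is_InfDef]) auto
qed

text \<open>Here \<open>z = - y\<close> and \<open>q = s = y\<close>, while \<open>x\<close> and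
  \<open>w\<close> make \<open>p = - x\<close> and \<open>r = x - 2 * w\<close> arbitrary. The
  invariant modulo coboundaries is \<open>s - q\<close>.\<close>

lemma B2_and_InfDef_E2:
  assumes "mu (e 1) (e 1) = e 1" and "mu (e 2) (e 2) = e 1"
  shows "B2_matrices = module.span matrix_scale {mat2 (-1) 0 1 0, mat2 0 1 0 1, mat2 0 0 (-2) 0}"
    and "is_InfDef {matrix_plus_t (mat2 1 0 1 0) (mat2 0 0 0 \<alpha>) | \<alpha>. True}"
proof -
  have A: "has_structure_matrix scale e mu (mat2 1 0 1 0)"
    using assms by (intro structure_matrix_mat2) simp_all
  have B2: "mat2 p q r s \<in> B2_matrices \<longleftrightarrow> s = q" for p q r s
    unfolding mat2_in_B2_iff[OF A]
    by (rule iffI, force simp: algebra_simps,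
        rule exI[of _ "- p"], rule exI[of _ q], rule exI[of _ "- q"],
        rule exI[of _ "- (p + r) / 2"], simp add: field_simps)
  have "mat2 p q r s \<in> B2_matrices \<longleftrightarrow> mat2 p q r s \<in> module.span matrix_scale
      {mat2 (-1) 0 1 0, mat2 0 1 0 1, mat2 0 0 (-2) 0}" for p q r s
    unfolding B2 mat2_in_span_iff
    by (rule iffI, rule exI[of _ "- p"], rule exI[of _ q], rule exI[of _ "- (p + r) / 2"],
        simp add: field_simps, force simp: algebra_simps)
  then show "B2_matrices = module.span matrix_scale {mat2 (-1) 0 1 0, mat2 0 1 0 1, mat2 0 0 (-2) 0}"
    by (rule mat2_set_eqI)
  have "\<exists>!N. N \<in> {mat2 0 0 0 \<alpha> | \<alpha>. True} \<and> N - mat2 p q r s \<in> B2_matrices" for p q r s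
    by (rule ex1I[of _ "mat2 0 0 0 (s - q)"], rule conjI, blast,
        simp add: mat2_diff B2 field_simps, auto simp: mat2_diff B2 mat2_eq_iff field_simps)
  from is_InfDef_mat2I[OF A this]
  show "is_InfDef {matrix_plus_t (mat2 1 0 1 0) (mat2 0 0 0 \<alpha>) | \<alpha>. True}"
    by (rule back_subst[of is_InfDef]) auto
qed

text \<open>Here \<open>y = z\<close>, and the matrix with all entries equal yields the zero
  coboundary, so \<open>y = z = 0\<close> may be chosen. Then \<open>x\<close> and \<open>w\<close>
  are read off from \<open>p\<close> and \<open>q\<close>: the top row determines the bottom
  row.\<close>

lemma B2_and_InfDef_E3:
  assumes "mu (e 1) (e 1) = e 1 + e 2" and "mu (e 2) (e 2) = - (e 1 + e 2)"
  shows "B2_matrices = module.span matrix_scale {mat2 1 1 (-1) (-1), mat2 0 1 2 1}"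
    and "is_InfDef {matrix_plus_t (mat2 1 1 (-1) (-1)) (mat2 0 0 \<alpha> \<beta>) | \<alpha> \<beta>. True}"
proof -
  have A: "has_structure_matrix scale e mu (mat2 1 1 (-1) (-1))"
    using assms by (intro structure_matrix_mat2) simp_all
  have B2: "mat2 p q r s \<in> B2_matrices \<longleftrightarrow> r = 2 * q - 3 * p \<and> s = q - 2 * p" for p q r s
    unfolding mat2_in_B2_iff[OF A]
    by (rule iffI, force simp: algebra_simps,
        rule exI[of _ "- p"], rule exI[of _ 0], rule exI[of _ 0], rule exI[of _ "q - 2 * p"],
        simp add: field_simps)
  have "mat2 p q r s \<in> B2_matrices \<longleftrightarrow> mat2 p q r s \<in> module.span matrix_scale
      {mat2 1 1 (-1) (-1), mat2 0 1 2 1}" for p q r s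
    unfolding B2 mat2_in_span_iff
    by (rule iffI, rule exI[of _ p], rule exI[of _ "q - p"], simp add: field_simps,
        force simp: algebra_simps)
  then show "B2_matrices = module.span matrix_scale {mat2 1 1 (-1) (-1), mat2 0 1 2 1}"
    by (rule mat2_set_eqI)
  have "\<exists>!N. N \<in> {mat2 0 0 \<alpha> \<beta> | \<alpha> \<beta>. True} \<and> N - mat2 p q r s \<in> B2_matrices" for p q r s
    by (rule ex1I[of _ "mat2 0 0 (r - 2 * q + 3 * p) (s - q + 2 * p)"], rule conjI, blast,
        simp add: mat2_diff B2 field_simps, auto simp: mat2_diff B2 mat2_eq_iff field_simps)
  from is_InfDef_mat2I[OF A this]
  show "is_InfDef {matrix_plus_t (mat2 1 1 (-1) (-1)) (mat2 0 0 \<alpha> \<beta>) | \<alpha> \<beta>. True}"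
    by (rule back_subst[of is_InfDef]) auto
qed

text \<open>The off-diagonal condition forces \<open>z = 0\<close>, and only
  \<open>q = w - 2 * x\<close> remains; the other three entries are invariants.\<close>

lemma B2_and_InfDef_E4:
  assumes "mu (e 1) (e 1) = e 2" and "mu (e 2) (e 2) = 0"
  shows "B2_matrices = module.span matrix_scale {mat2 0 1 0 0}"
    and "is_InfDef {matrix_plus_t (mat2 0 1 0 0) (mat2 \<alpha> 0 \<beta> \<gamma>) | \<alpha> \<beta> \<gamma>. True}"
proof -
  have A: "has_structure_matrix scale e mu (mat2 0 1 0 0)"
    using assms by (intro structure_matrix_mat2) simp_all
  have B2: "mat2 p q r s \<in> B2_matrices \<longleftrightarrow> p = 0 \<and> r = 0 \<and> s = 0" for p q r s
    unfolding mat2_in_B2_iff[OF A]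
    by (rule iffI, force simp: algebra_simps,
        rule exI[of _ 0], rule exI[of _ 0], rule exI[of _ 0], rule exI[of _ q],
        simp add: field_simps)
  have "mat2 p q r s \<in> B2_matrices \<longleftrightarrow> mat2 p q r s \<in> module.span matrix_scale
      {mat2 0 1 0 0}" for p q r s
    unfolding B2 mat2_in_span_iff
    by (rule iffI, rule exI[of _ q], simp add: field_simps, force simp: algebra_simps)
  then show "B2_matrices = module.span matrix_scale {mat2 0 1 0 0}"
    by (rule mat2_set_eqI)
  have "\<exists>!N. N \<in> {mat2 \<alpha> 0 \<beta> \<gamma> | \<alpha> \<beta> \<gamma>. True} \<and> N - mat2 p q r s \<in> B2_matrices" for p q r s
    by (rule ex1I[of _ "mat2 p 0 r s"], rule conjI, blast,
        simp add: mat2_diff B2 field_simps, auto simp: mat2_diff B2 mat2_eq_iff field_simps)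
  from is_InfDef_mat2I[OF A this]
  show "is_InfDef {matrix_plus_t (mat2 0 1 0 0) (mat2 \<alpha> 0 \<beta> \<gamma>) | \<alpha> \<beta> \<gamma>. True}"
    by (rule back_subst[of is_InfDef]) auto
qed

text \<open>Only diagonal \<open>\<phi>\<close> occur, so a coboundary is determined by
  \<open>p = - x\<close> and \<open>s = - w\<close>. The cases select entries that also determine
  it: the top row if \<open>a2 \<noteq> 0\<close>, the diagonal if \<open>a2 = a3 = 0\<close>. If
  \<open>a2 = 0\<close> and \<open>a3 \<noteq> 0\<close>, it is the left column; the remaining
  entries parametrise the deformations.\<close>

lemma B2_and_InfDef_E5:
  assumes "1 - a2 * a3 \<noteq> 0"
    and "mu (e 1) (e 1) = e 1 + scale a2 (e 2)" and "mu (e 2) (e 2) = scale a3 (e 1) + e 2"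
  shows "B2_matrices = module.span matrix_scale {mat2 (-1) (-2 * a2) a3 0, mat2 0 a2 (-2 * a3) (-1)}"
    and "a2 \<noteq> 0 \<Longrightarrow> is_InfDef {matrix_plus_t (mat2 1 a2 a3 1) (mat2 0 0 \<alpha> \<beta>) | \<alpha> \<beta>. True}"
    and "a2 = 0 \<Longrightarrow> a3 = 0 \<Longrightarrow>
      is_InfDef {matrix_plus_t (mat2 1 0 0 1) (mat2 0 \<alpha> \<beta> 0) | \<alpha> \<beta>. True}"
    and "a2 = 0 \<Longrightarrow> a3 \<noteq> 0 \<Longrightarrow>
      is_InfDef {matrix_plus_t (mat2 1 0 a3 1) (mat2 0 \<alpha> 0 \<beta>) | \<alpha> \<beta>. True}"
proof -
  have A: "has_structure_matrix scale e mu (mat2 1 a2 a3 1)"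
    using assms by (intro structure_matrix_mat2) simp_all
  \<comment> \<open>A homogeneous system whose determinant is \<open>1 - a2 * a3\<close>, nonzero by
    assumption.\<close>
  have offdiag: "z = 0 \<and> y = 0" if "z + y * a3 = 0" "z * a2 + y = 0" for y z
  proof -
    have "(1 - a2 * a3) * y = 0" using that by algebra
    then show ?thesis using assms(1) that by simp
  qed
  have B2: "mat2 p q r s \<in> B2_matrices \<longleftrightarrow>
      q = 2 * a2 * p - a2 * s \<and> r = 2 * a3 * s - a3 * p" for p q r s
    unfolding mat2_in_B2_iff[OF A]
  proof (intro iffI)
    assume "\<exists>x y z w. z * 1 + y * a3 = 0 \<and> z * a2 + y * 1 = 0 \<and>
      p = a2 * z - 1 * x \<and> q = 1 * y + a2 * w - 2 * x * a2 \<and>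
      r = a3 * x + 1 * z - 2 * w * a3 \<and> s = a3 * y - 1 * w"
    then obtain x y z w where zy: "z + y * a3 = 0" "z * a2 + y = 0" and
      eqs: "p = a2 * z - x" "q = y + a2 * w - 2 * x * a2"
        "r = a3 * x + z - 2 * w * a3" "s = a3 * y - w"
      by (simp only: mult_1_left mult_1_right) blast
    have "z = 0" "y = 0" using offdiag[OF zy] by simp_all
    then show "q = 2 * a2 * p - a2 * s \<and> r = 2 * a3 * s - a3 * p"
      by (simp add: eqs algebra_simps)
  next
    assume "q = 2 * a2 * p - a2 * s \<and> r = 2 * a3 * s - a3 * p"
    then show "\<exists>x y z w. z * 1 + y * a3 = 0 \<and> z * a2 + y * 1 = 0 \<and>
      p = a2 * z - 1 * x \<and> q = 1 * y + a2 * w - 2 * x * a2 \<and>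
      r = a3 * x + 1 * z - 2 * w * a3 \<and> s = a3 * y - 1 * w"
      by - (rule exI[of _ "- p"], rule exI[of _ 0], rule exI[of _ 0], rule exI[of _ "- s"],
          simp_all)
  qed
  have "mat2 p q r s \<in> B2_matrices \<longleftrightarrow> mat2 p q r s \<in> module.span matrix_scale
      {mat2 (-1) (-2 * a2) a3 0, mat2 0 a2 (-2 * a3) (-1)}" for p q r s
    unfolding B2 mat2_in_span_iff
    by (rule iffI, rule exI[of _ "- p"], rule exI[of _ "- s"], simp,
        elim exE conjE, intro conjI; algebra)
  then show "B2_matrices = module.span matrix_scale {mat2 (-1) (-2 * a2) a3 0, mat2 0 a2 (-2 * a3) (-1)}"
    by (rule mat2_set_eqI)
  show "is_InfDef {matrix_plus_t (mat2 1 a2 a3 1) (mat2 0 0 \<alpha> \<beta>) | \<alpha> \<beta>. True}" if "a2 \<noteq> 0"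
  proof -
    have "mat2 0 0 \<alpha> \<beta> - mat2 p q r s \<in> B2_matrices \<longleftrightarrow>
        \<beta> = s + q / a2 - 2 * p \<and> \<alpha> = r + a3 * p + 2 * a3 * (\<beta> - s)" for \<alpha> \<beta> p q r s
    proof -
      \<comment> \<open>The top right equation for the difference; dividing by \<open>a2\<close>
        fixes \<open>\<beta>\<close>, and the bottom left equation then gives
        \<open>\<alpha>\<close>.\<close>
      have "- q = 2 * a2 * (- p) - a2 * (\<beta> - s) \<longleftrightarrow> \<beta> = s + q / a2 - 2 * p"
        using that by (simp add: field_simps)
      then show ?thesis by (simp add: mat2_diff B2 algebra_simps)
    qed
    then have "\<exists>!N. N \<in> {mat2 0 0 \<alpha> \<beta> | \<alpha> \<beta>. True} \<and> N - mat2 p q r s \<in> B2_matrices"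
      for p q r s
      by (intro ex1I[of _ "mat2 0 0 (r + a3 * p + 2 * a3 * (q / a2 - 2 * p)) (s + q / a2 - 2 * p)"])
        auto
    from is_InfDef_mat2I[OF A this] show ?thesis
      by (rule back_subst[of is_InfDef]) auto
  qed
  show "is_InfDef {matrix_plus_t (mat2 1 0 0 1) (mat2 0 \<alpha> \<beta> 0) | \<alpha> \<beta>. True}"
    if "a2 = 0" "a3 = 0"
  proof -
    have "\<exists>!N. N \<in> {mat2 0 \<alpha> \<beta> 0 | \<alpha> \<beta>. True} \<and> N - mat2 p q r s \<in> B2_matrices" for p q r s
      by (rule ex1I[of _ "mat2 0 q r 0"], rule conjI, blast)
        (use that in \<open>auto simp: mat2_diff B2\<close>)
    from is_InfDef_mat2I[OF A this] show ?thesis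
      by (rule back_subst[of is_InfDef]) (use that in auto)
  qed
  show "is_InfDef {matrix_plus_t (mat2 1 0 a3 1) (mat2 0 \<alpha> 0 \<beta>) | \<alpha> \<beta>. True}"
    if "a2 = 0" "a3 \<noteq> 0"
  proof -
    have "mat2 0 \<alpha> 0 \<beta> - mat2 p q r s \<in> B2_matrices \<longleftrightarrow>
        \<alpha> = q \<and> \<beta> = s - (r / a3 + p) / 2" for \<alpha> \<beta> p q r s
    proof -
      \<comment> \<open>The bottom left equation for the difference, solved by dividing by
        \<open>2 * a3\<close>.\<close>
      have "- r = 2 * a3 * (\<beta> - s) - a3 * (- p) \<longleftrightarrow> \<beta> = s - (r / a3 + p) / 2"
        using that by (simp add: field_simps) (auto simp: algebra_simps)
      then show ?thesis using that by (simp add: mat2_diff B2)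
    qed
    then have "\<exists>!N. N \<in> {mat2 0 \<alpha> 0 \<beta> | \<alpha> \<beta>. True} \<and> N - mat2 p q r s \<in> B2_matrices"
      for p q r s
      by (intro ex1I[of _ "mat2 0 q 0 (s - (r / a3 + p) / 2)"]) auto
    from is_InfDef_mat2I[OF A this] show ?thesis
      by (rule back_subst[of is_InfDef]) (use that in auto)
  qed
qed

text \<open>Again \<open>y = z = 0\<close>, so \<open>p = 0\<close>. The system
  \<open>q = w - 2 * x\<close>, \<open>r = x - 2 * w\<close> has determinant 3 up to sign, so
  \<open>q\<close> and \<open>r\<close> are arbitrary and determine \<open>s = - (a4 * w)\<close>;
  diagonal matrices represent the cosets.\<close>

lemma B2_and_InfDef_E6:
  assumes "mu (e 1) (e 1) = e 2" and "mu (e 2) (e 2) = e 1 + scale a4 (e 2)"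
  shows "B2_matrices = module.span matrix_scale {mat2 0 1 (-2) (- a4), mat2 0 (-2) 1 0}"
    and "is_InfDef {matrix_plus_t (mat2 0 1 1 a4) (mat2 \<alpha> 0 0 \<beta>) | \<alpha> \<beta>. True}"
proof -
  have A: "has_structure_matrix scale e mu (mat2 0 1 1 a4)"
    using assms by (intro structure_matrix_mat2) simp_all
  have B2: "mat2 p q r s \<in> B2_matrices \<longleftrightarrow> p = 0 \<and> s = a4 * (q + 2 * r) / 3" for p q r s
    unfolding mat2_in_B2_iff[OF A]
  proof (intro iffI)
    assume "\<exists>x y z w. z * 0 + y * 1 = 0 \<and> z * 1 + y * a4 = 0 \<and>
      p = 1 * z - 0 * x \<and> q = 0 * y + 1 * w - 2 * x * 1 \<and>
      r = 1 * x + a4 * z - 2 * w * 1 \<and> s = 1 * y - a4 * w"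
    then obtain x w where eqs: "p = 0" "q = w - 2 * x" "r = x - 2 * w" "s = - (a4 * w)" by auto
    show "p = 0 \<and> s = a4 * (q + 2 * r) / 3" by (simp add: eqs algebra_simps)
  next
    assume "p = 0 \<and> s = a4 * (q + 2 * r) / 3"
    then show "\<exists>x y z w. z * 0 + y * 1 = 0 \<and> z * 1 + y * a4 = 0 \<and>
      p = 1 * z - 0 * x \<and> q = 0 * y + 1 * w - 2 * x * 1 \<and>
      r = 1 * x + a4 * z - 2 * w * 1 \<and> s = 1 * y - a4 * w"
      \<comment> \<open>Solution of that system: \<open>2 * q + r = - 3 * x\<close> and
        \<open>q + 2 * r = - 3 * w\<close>. The same values serve as span coefficients
        below.\<close>
      by - (rule exI[of _ "- (2 * q + r) / 3"], rule exI[of _ 0], rule exI[of _ 0],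
        rule exI[of _ "- (q + 2 * r) / 3"],
        simp add: field_simps)
  qed
  have "mat2 p q r s \<in> B2_matrices \<longleftrightarrow> mat2 p q r s \<in> module.span matrix_scale
      {mat2 0 1 (-2) (- a4), mat2 0 (-2) 1 0}" for p q r s
    unfolding B2 mat2_in_span_iff
  proof (intro iffI)
    assume "p = 0 \<and> s = a4 * (q + 2 * r) / 3"
    then show "\<exists>k l. p - k * 0 - l * 0 = 0 \<and> q - k * 1 - l * - 2 = 0 \<and>
        r - k * - 2 - l * 1 = 0 \<and> s - k * - a4 - l * 0 = 0"
      by - (rule exI[of _ "- (q + 2 * r) / 3"], rule exI[of _ "- (2 * q + r) / 3"],
          simp add: field_simps)
  next
    assume "\<exists>k l. p - k * 0 - l * 0 = 0 \<and> q - k * 1 - l * - 2 = 0 \<and>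
        r - k * - 2 - l * 1 = 0 \<and> s - k * - a4 - l * 0 = 0"
    \<comment> \<open>Clearing the denominator makes this a polynomial identity, within reach of
      \<open>algebra\<close>.\<close>
    then have "p = 0 \<and> s * 3 = a4 * (q + 2 * r)"
      by (elim exE conjE, intro conjI; algebra)
    then show "p = 0 \<and> s = a4 * (q + 2 * r) / 3"
      by (simp add: eq_divide_eq)
  qed
  then show "B2_matrices = module.span matrix_scale {mat2 0 1 (-2) (- a4), mat2 0 (-2) 1 0}"
    by (rule mat2_set_eqI)
  have "mat2 \<alpha> 0 0 \<beta> - mat2 p q r s \<in> B2_matrices \<longleftrightarrow>
      \<alpha> = p \<and> \<beta> = s - a4 * (q + 2 * r) / 3" for \<alpha> \<beta> p q r s
  proof -
    have "\<beta> - s = a4 * (- q + 2 * (- r)) / 3 \<longleftrightarrow> \<beta> = s - a4 * (q + 2 * r) / 3"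
      by (simp add: field_simps)
    then show ?thesis by (simp add: mat2_diff B2)
  qed
  then have "\<exists>!N. N \<in> {mat2 \<alpha> 0 0 \<beta> | \<alpha> \<beta>. True} \<and> N - mat2 p q r s \<in> B2_matrices"
    for p q r s
    by (intro ex1I[of _ "mat2 p 0 0 (s - a4 * (q + 2 * r) / 3)"]) auto
  from is_InfDef_mat2I[OF A this]
  show "is_InfDef {matrix_plus_t (mat2 0 1 1 a4) (mat2 \<alpha> 0 0 \<beta>) | \<alpha> \<beta>. True}"
    by (rule back_subst[of is_InfDef]) auto
qed

end

theorem theorem4p5:
  fixes scale :: "complex \<Rightarrow> 'v::ab_group_add \<Rightarrow> 'v" and e :: "2 \<Rightarrow> 'v" and mu :: "'v \<Rightarrow> 'v \<Rightarrow> 'v"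
  assumes "evolution_algebra scale e mu"
  shows
    "(mu (e 1) (e 1) = e 1 \<and> mu (e 2) (e 2) = 0 \<longrightarrow>
        evolution_algebra.B2_matrices scale e mu = module.span matrix_scale
          {vector [vector [1, 0], vector [0, 0]],
           vector [vector [0, 1], vector [0, 0]]} \<and>
        evolution_algebra.is_InfDef scale e mu
          {matrix_plus_t
             (vector [vector [1, 0], vector [0, 0]])
             (vector [vector [0, 0], vector [\<alpha>, \<beta>]]) | \<alpha> \<beta>. True}) \<and>
     (mu (e 1) (e 1) = e 1 \<and> mu (e 2) (e 2) = e 1 \<longrightarrow>
        evolution_algebra.B2_matrices scale e mu = module.span matrix_scale
          {vector [vector [-1, 0], vector [1, 0]],
           vector [vector [0, 1], vector [0, 1]],
           vector [vector [0, 0], vector [-2, 0]]} \<and>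
        evolution_algebra.is_InfDef scale e mu
          {matrix_plus_t
             (vector [vector [1, 0], vector [1, 0]])
             (vector [vector [0, 0], vector [0, \<alpha>]]) | \<alpha>. True}) \<and>
     (mu (e 1) (e 1) = e 1 + e 2 \<and> mu (e 2) (e 2) = - (e 1 + e 2) \<longrightarrow>
        evolution_algebra.B2_matrices scale e mu = module.span matrix_scale
          {vector [vector [1, 1], vector [-1, -1]],
           vector [vector [0, 1], vector [2, 1]]} \<and>
        evolution_algebra.is_InfDef scale e mu
          {matrix_plus_t
             (vector [vector [1, 1], vector [-1, -1]])
             (vector [vector [0, 0], vector [\<alpha>, \<beta>]]) | \<alpha> \<beta>. True}) \<and>
     (mu (e 1) (e 1) = e 2 \<and> mu (e 2) (e 2) = 0 \<longrightarrow>
        evolution_algebra.B2_matrices scale e mu = module.span matrix_scale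
          {vector [vector [0, 1], vector [0, 0]]} \<and>
        evolution_algebra.is_InfDef scale e mu
          {matrix_plus_t
             (vector [vector [0, 1], vector [0, 0]])
             (vector [vector [\<alpha>, 0], vector [\<beta>, \<gamma>]]) | \<alpha> \<beta> \<gamma>. True}) \<and>
     (\<forall>a2 a3. 1 - a2 * a3 \<noteq> 0 \<longrightarrow>
      mu (e 1) (e 1) = e 1 + scale a2 (e 2) \<and> mu (e 2) (e 2) = scale a3 (e 1) + e 2 \<longrightarrow>
        evolution_algebra.B2_matrices scale e mu = module.span matrix_scale
          {vector [vector [-1, -2 * a2], vector [a3, 0]],
           vector [vector [0, a2], vector [-2 * a3, -1]]} \<and>
        (a2 \<noteq> 0 \<longrightarrow> evolution_algebra.is_InfDef scale e mu
          {matrix_plus_t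
             (vector [vector [1, a2], vector [a3, 1]])
             (vector [vector [0, 0], vector [\<alpha>, \<beta>]]) | \<alpha> \<beta>. True}) \<and>
        (a2 = 0 \<and> a3 = 0 \<longrightarrow> evolution_algebra.is_InfDef scale e mu
          {matrix_plus_t
             (vector [vector [1, 0], vector [0, 1]])
             (vector [vector [0, \<alpha>], vector [\<beta>, 0]]) | \<alpha> \<beta>. True}) \<and>
        (a2 = 0 \<and> a3 \<noteq> 0 \<longrightarrow> evolution_algebra.is_InfDef scale e mu
          {matrix_plus_t
             (vector [vector [1, 0], vector [a3, 1]])
             (vector [vector [0, \<alpha>], vector [0, \<beta>]]) | \<alpha> \<beta>. True})) \<and>
     (\<forall>a4. mu (e 1) (e 1) = e 2 \<and> mu (e 2) (e 2) = e 1 + scale a4 (e 2) \<longrightarrow>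
        evolution_algebra.B2_matrices scale e mu = module.span matrix_scale
          {vector [vector [0, 1], vector [-2, - a4]],
           vector [vector [0, -2], vector [1, 0]]} \<and>
        evolution_algebra.is_InfDef scale e mu
          {matrix_plus_t
             (vector [vector [0, 1], vector [1, a4]])
             (vector [vector [\<alpha>, 0], vector [0, \<beta>]]) | \<alpha> \<beta>. True})"
proof -
  interpret evolution_algebra_2 scale e mu
    using assms by (rule evolution_algebra_2.intro)
  show ?thesis
    by (intro conjI allI impI; elim conjE)
      (assumption | rule B2_and_InfDef_E1 B2_and_InfDef_E2 B2_and_InfDef_E3 B2_and_InfDef_E4
        B2_and_InfDef_E5 B2_and_InfDef_E6)+
qed

end
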